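(* Let $\Delta\geq 1$, $q\geq 2\Delta$, and let $G$ be a graph with maximum degree $\Delta$. Let $\vec\lambda\in\mathbb C^q$ be valid, i.e. for all $i,j\in[q]$: (1) $\lambda_i\notin(-\infty,0]$; (2) $|\arg(\lambda_i)|\le \nu\epsilon_I/2$; (3) $|\Re\ln(\lambda_i/\lambda_j)|\le\Delta\epsilon_I$, where $\nu=0.9$ and $\epsilon_I=10^{-4}\Delta^{-4}$. Then $Z_G(\vec\lambda)\neq0$.
   Context: For a graph $G=(V,E)$ and $\vec\lambda\in\mathbb C^q$, the coloring-model partition function is $Z_G(\vec\lambda)=\sum_{\sigma}\prod_{i=1}^q\lambda_i^{|\sigma^{-1}(i)|}$, the sum over all proper colorings $\sigma:V\to[q]$ (i.e. $\sigma(u)\ne\sigma(v)$ for every edge $uv$). $\ln$ denotes the principal branch of the logarithm on $\mathbb C\setminus(-\infty,0]$ and $\arg z=\Im\ln z\in(-\pi,\pi)$. *)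

theory Defs
  imports
    "HOL-Analysis.Analysis"
    "HOL-Library.FuncSet"
    "HOL-Library.Nonpos_Ints"
    "Graph_Theory.Pair_Digraph"
begin

text \<open>
  A finite simple graph is a \<^locale>\<open>pair_graph\<close>: every undirected edge \<open>uv\<close> is represented by
  the two arcs \<open>(u, v)\<close> and \<open>(v, u)\<close>, so the number of edges at \<open>v\<close> is the
  out-degree of \<open>v\<close> and not the sum of its in- and out-degree.
  The colors \<open>[q]\<close> are the numbers \<open>1, \<dots>, q\<close>; a weight vector is a function on
  the naturals of which only the values on \<open>{1..q}\<close> are used.
\<close>

text \<open>The element \<open>0\<close> only serves to make the maximum meaningful for the graph without vertices.\<close>

definition max_degree :: "'a pair_pre_digraph \<Rightarrow> nat" where
  "max_degree G = Max (insert 0 (out_degree (with_proj G) ` pverts G))"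

definition proper_colorings :: "'a pair_pre_digraph \<Rightarrow> nat \<Rightarrow> ('a \<Rightarrow> nat) set" where
  "proper_colorings G q =
     {\<sigma> \<in> pverts G \<rightarrow>\<^sub>E {1..q}. \<forall>(u, v) \<in> parcs G. \<sigma> u \<noteq> \<sigma> v}"

definition coloring_partition_function ::
    "'a pair_pre_digraph \<Rightarrow> nat \<Rightarrow> (nat \<Rightarrow> complex) \<Rightarrow> complex" where
  "coloring_partition_function G q lam =
     (\<Sum>\<sigma> \<in> proper_colorings G q. \<Prod>i = 1..q. lam i ^ card {v \<in> pverts G. \<sigma> v = i})"

definition nu :: real where
  "nu = 9 / 10"

definition eps_I :: "nat \<Rightarrow> real" where
  "eps_I \<Delta> = 1 / (10 ^ 4 * real \<Delta> ^ 4)"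

definition valid_weights :: "nat \<Rightarrow> nat \<Rightarrow> (nat \<Rightarrow> complex) \<Rightarrow> bool" where
  "valid_weights \<Delta> q lam \<longleftrightarrow>
     (\<forall>i \<in> {1..q}. \<forall>j \<in> {1..q}.
        lam i \<notin> \<real>\<^sub>\<le>\<^sub>0 \<and>
        \<bar>Im (Ln (lam i))\<bar> \<le> nu * eps_I \<Delta> / 2 \<and>
        \<bar>Re (Ln (lam i / lam j))\<bar> \<le> real \<Delta> * eps_I \<Delta>)"

end

theory Submission
  imports Defs
begin

text \<open>
  The statement is proved for list colorings with \<open>card (L v) \<ge> 2 * deg v\<close>, by induction on the vertex
  set. Let \<open>\<eta> = 2 * \<Delta> * \<epsilon>\<^sub>I\<close>, so that \<open>\<lambda>\<^sub>i / \<lambda>\<^sub>j = exp w\<close> with \<open>\<bar>w\<bar> \<le> \<eta>\<close>. Divide the partition function by the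
  number of colorings. Then, for a vertex \<open>u\<close> of degree \<open>d\<close>, the normalised partition functions with \<open>u\<close>
  colored \<open>i\<close> and \<open>j\<close> differ by a factor \<open>exp w\<close> with \<open>\<bar>w\<bar> \<le> (2 * d + 1) * \<eta>\<close>; real and imaginary part of \<open>w\<close>
  need not be treated separately. To see this, change the color forbidden at the neighbors of \<open>u\<close> from
  \<open>j\<close> to \<open>i\<close>, one neighbor \<open>v\<close> at a time. Each change compares two averages of the same complex numbers
  over \<open>L v - {i}\<close> and \<open>L v - {j}\<close>, weighted by numbers of colorings. With \<open>d\<close> now the degree of \<open>v\<close> without
  \<open>u\<close>, the numbers lie within about \<open>(2 * d + 1) * \<eta>\<close> of each other by induction. As \<open>v\<close> has at least \<open>d + 2\<close>
  available colors, no color has probability above \<open>1 / (d + 2)\<close>, so the two distributions have total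
  variation distance at most \<open>1 / (d + 1)\<close>. Hence the averages differ by a factor within about
  \<open>(2 * d + 1) / (d + 1) * \<eta>\<close>, which is less than \<open>2 * \<eta>\<close> with room for the second order terms.
  Nonvanishing follows because a sum of numbers with nearly equal arguments is not zero.
\<close>

section \<open>Averages of nearly equal complex numbers\<close>

text \<open>Since \<open>q - r\<close> sums to 0, the values may be recentered at
  \<open>y i\<close>, which removes the term at \<open>i\<close>. The remaining coefficients
  \<open>q c - r c\<close> are nonnegative and add up to \<open>r i - q i\<close>.\<close>

lemma weighted_average_diff:
  fixes y :: "'b \<Rightarrow> complex" and q r :: "'b \<Rightarrow> real"
  assumes "finite L" "i \<in> L" "sum q L = 1" "sum r L = 1"
    and "\<And>c. c \<in> L - {i} \<Longrightarrow> r c \<le> q c" and "0 \<le> q i"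
    and "\<And>c. c \<in> L \<Longrightarrow> norm (y c - y i) \<le> \<delta>" and "0 \<le> \<delta>"
  shows "norm ((\<Sum>c\<in>L. q c * y c) - (\<Sum>c\<in>L. r c * y c)) \<le> r i * \<delta>"
proof -
  have s: "(\<Sum>c\<in>L. of_real (q c - r c) :: complex) = 0"
    using assms(3,4) by (simp add: sum_subtractf flip: of_real_sum)
  have "(\<Sum>c\<in>L. q c * y c) - (\<Sum>c\<in>L. r c * y c) = (\<Sum>c\<in>L. of_real (q c - r c) * y c)"
    by (simp add: sum_subtractf algebra_simps)
  also have "\<dots> = (\<Sum>c\<in>L. of_real (q c - r c) * (y c - y i))"
    using s by (simp add: right_diff_distrib sum_subtractf flip: sum_distrib_right)
  also have "\<dots> = (\<Sum>c\<in>L - {i}. of_real (q c - r c) * (y c - y i))"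
    using sum.remove[OF assms(1,2), of "\<lambda>c. of_real (q c - r c) * (y c - y i)"] by simp
  finally have "norm ((\<Sum>c\<in>L. q c * y c) - (\<Sum>c\<in>L. r c * y c))
      \<le> (\<Sum>c\<in>L - {i}. norm (of_real (q c - r c) * (y c - y i)))"
    by (simp only: norm_sum)
  also have "\<dots> \<le> (\<Sum>c\<in>L - {i}. (q c - r c) * \<delta>)"
  proof (rule sum_mono)
    fix c assume c: "c \<in> L - {i}"
    have "norm (of_real (q c - r c) * (y c - y i)) = (q c - r c) * norm (y c - y i)"
      using assms(5)[OF c] by (simp add: norm_mult del: of_real_diff)
    also have "\<dots> \<le> (q c - r c) * \<delta>"
      using assms(5)[OF c] assms(7)[of c] c by (intro mult_left_mono) auto
    finally show "norm (of_real (q c - r c) * (y c - y i)) \<le> (q c - r c) * \<delta>" .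
  qed
  also have "\<dots> = (r i - q i) * \<delta>"
  proof -
    have "sum q L = q i + sum q (L - {i})" "sum r L = r i + sum r (L - {i})"
      using sum.remove[OF assms(1,2)] by blast+
    then have "sum q (L - {i}) - sum r (L - {i}) = r i - q i"
      using assms(3,4) by linarith
    then show ?thesis by (simp add: sum_subtractf flip: sum_distrib_right)
  qed
  also have "\<dots> \<le> r i * \<delta>" using assms(6,8) by (simp add: mult_right_mono)
  finally show ?thesis .
qed

definition wavg :: "('b \<Rightarrow> real) \<Rightarrow> ('b \<Rightarrow> complex) \<Rightarrow> 'b set \<Rightarrow> complex" where
  "wavg n X L = (\<Sum>c\<in>L. n c * X c) / of_real (sum n L)"

lemma wavg_near:
  fixes X :: "'b \<Rightarrow> complex"
  assumes "finite L" "L \<noteq> {}" "\<And>c. c \<in> L \<Longrightarrow> n c > 0"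
    and "\<And>c. c \<in> L \<Longrightarrow> norm (X c - a) \<le> \<delta>"
  shows "norm (wavg n X L - a) \<le> \<delta>"
proof -
  have n: "sum n L > 0" using assms(1-3) by (intro sum_pos) auto
  then have nz: "(of_real (sum n L) :: complex) \<noteq> 0" by (metis less_irrefl of_real_eq_0_iff)
  have "wavg n X L - a = (\<Sum>c\<in>L. n c * (X c - a)) / of_real (sum n L)"
    using nz unfolding wavg_def
    by (simp add: field_simps sum_subtractf sum_distrib_left del: of_real_sum)
       (simp add: sum_distrib_left mult.commute)
  moreover have "norm (\<Sum>c\<in>L. n c * (X c - a)) \<le> (\<Sum>c\<in>L. n c * \<delta>)"
    using assms(3,4) by (intro sum_norm_le) (simp add: norm_mult mult_left_mono less_imp_le)
  ultimately show ?thesis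
    using n by (simp add: norm_divide divide_le_eq sum_distrib_left mult.commute del: of_real_sum)
qed

text \<open>The two averages differ by at most the diameter times the total variation distance of the
  underlying probability distributions, which is \<open>n i / (sum n L - n j)\<close> if \<open>n j \<le> n i\<close>.\<close>

lemma wavg_remove_diff:
  fixes X :: "'b \<Rightarrow> complex"
  assumes fin: "finite L" and pos: "\<And>c. c \<in> L \<Longrightarrow> n c > 0"
    and bound: "\<And>c. c \<in> L \<Longrightarrow> (real d + 2) * n c \<le> sum n L"
    and diam: "\<And>c c'. c \<in> L \<Longrightarrow> c' \<in> L \<Longrightarrow> norm (X c - X c') \<le> \<delta>" and "\<delta> \<ge> 0"
  shows "norm (wavg n X (L - {i}) - wavg n X (L - {j})) \<le> \<delta> / (real d + 1)"
proof -
  \<comment> \<open>Extending \<open>n\<close> by 0 covers the case that \<open>i\<close> or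
    \<open>j\<close> lies outside \<open>L\<close>, where its removal changes nothing.\<close>
  define m where "m k = (if k \<in> L then n k else 0)" for k
  have *: "norm (wavg n X (L - {i}) - wavg n X (L - {j})) \<le> \<delta> / (real d + 1)"
    if "m j \<le> m i" for i j
  proof (cases "i = j \<or> i \<notin> L")
    case True
    then have "L - {i} = L - {j}"
      using that pos[of j] by (auto simp: m_def split: if_splits)
    then show ?thesis using \<open>\<delta> \<ge> 0\<close> by simp
  next
    case False
    then have ij: "i \<noteq> j" "i \<in> L" by auto
    define s where "s = sum n L"
    have sk: "sum n (L - {k}) = s - m k" for k
      using fin by (auto simp: s_def m_def sum_diff1)
    have mi: "(real d + 2) * m i \<le> s" "m i > 0" "m i = n i"
      using bound[OF ij(2)] pos ij by (auto simp: m_def s_def)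
    have mj: "0 \<le> m j" using pos[of j] by (auto simp: m_def)
    have s_big: "s \<ge> 2 * m i"
      using mi mult_right_mono[of 2 "real d + 2" "m i"] by linarith
    then have si: "s - m i > 0" "s - m j > 0" using mi that by auto
    \<comment> \<open>The distribution on \<open>L - {k}\<close>, extended by 0 so that both
      averages run over \<open>L\<close>.\<close>
    define q where "q k c = (if c = k then 0 else n c / (s - m k))" for k c
    have qsum: "sum (q k) L = 1" if "s - m k > 0" for k
    proof -
      have "sum (q k) L = sum (q k) (L - {k})"
        using fin by (intro sum.mono_neutral_right) (auto simp: q_def)
      also have "\<dots> = (\<Sum>c\<in>L - {k}. n c / (s - m k))"
        by (rule sum.cong) (auto simp: q_def)
      also have "\<dots> = 1" using that by (simp add: sk flip: sum_divide_distrib)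
      finally show ?thesis .
    qed
    have qavg: "wavg n X (L - {k}) = (\<Sum>c\<in>L. q k c * X c)" for k
    proof -
      have "(\<Sum>c\<in>L. q k c * X c) = (\<Sum>c\<in>L - {k}. q k c * X c)"
        using fin by (intro sum.mono_neutral_right) (auto simp: q_def)
      also have "\<dots> = (\<Sum>c\<in>L - {k}. n c * X c / of_real (s - m k))"
        by (rule sum.cong) (auto simp: q_def)
      finally show ?thesis by (simp add: wavg_def sk sum_divide_distrib del: of_real_sum)
    qed
    have "norm ((\<Sum>c\<in>L. q i c * X c) - (\<Sum>c\<in>L. q j c * X c)) \<le> q j i * \<delta>"
    proof (rule weighted_average_diff[OF fin ij(2) qsum qsum])
      fix c assume "c \<in> L - {i}"
      then show "q j c \<le> q i c"
        using si that pos[of c] by (auto simp: q_def intro!: divide_left_mono mult_pos_pos)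
    qed (use si diam ij \<open>\<delta> \<ge> 0\<close> in \<open>auto simp: q_def\<close>)
    also have "q j i \<le> 1 / (real d + 1)"
    proof -
      \<comment> \<open>One of the \<open>d + 2\<close> copies of \<open>n i\<close> below
        \<open>s\<close> pays for \<open>m j\<close>.\<close>
      have "(real d + 1) * n i \<le> s - m j" using mi that by (simp add: algebra_simps)
      then show ?thesis using si ij by (simp add: q_def field_simps)
    qed
    then have "q j i * \<delta> \<le> 1 / (real d + 1) * \<delta>" using \<open>\<delta> \<ge> 0\<close> by (rule mult_right_mono)
    finally show ?thesis by (simp add: qavg)
  qed
  show ?thesis
  proof (cases "m j \<le> m i")
    case True
    then show ?thesis by (rule *)
  next
    case False
    then have "m i \<le> m j" by simp
    from *[OF this] show ?thesis by (simp only: norm_minus_commute)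
  qed
qed

section \<open>Multiplicative closeness of complex numbers\<close>

text \<open>The existential exponent avoids a choice of branch for the logarithm of
  \<open>x / y\<close>, so radii simply add under products and chaining.\<close>

definition log_close :: "real \<Rightarrow> complex \<Rightarrow> complex \<Rightarrow> bool" where
  "log_close r x y \<longleftrightarrow> (\<exists>w. norm w \<le> r \<and> x = exp w * y)"

lemma log_close_refl: "r \<ge> 0 \<Longrightarrow> log_close r x x"
  unfolding log_close_def by (rule exI[of _ 0]) simp

lemma log_close_mult:
  assumes "log_close r x y" "log_close s x' y'"
  shows "log_close (r + s) (x * x') (y * y')"
proof -
  obtain w where w: "norm w \<le> r" "x = exp w * y"
    using assms(1) unfolding log_close_def by blast
  obtain w' where w': "norm w' \<le> s" "x' = exp w' * y'"
    using assms(2) unfolding log_close_def by blast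
  have "norm (w + w') \<le> r + s" using w(1) w'(1) by (rule norm_triangle_mono)
  moreover have "x * x' = exp (w + w') * (y * y')" unfolding w(2) w'(2) exp_add by (simp only: mult_ac)
  ultimately show ?thesis unfolding log_close_def by blast
qed

lemma log_close_trans:
  assumes "log_close r x y" "log_close s y z"
  shows "log_close (r + s) x z"
proof -
  obtain w where w: "norm w \<le> r" "x = exp w * y"
    using assms(1) unfolding log_close_def by blast
  obtain w' where w': "norm w' \<le> s" "y = exp w' * z"
    using assms(2) unfolding log_close_def by blast
  have "norm (w + w') \<le> r + s" using w(1) w'(1) by (rule norm_triangle_mono)
  moreover have "x = exp (w + w') * z" unfolding w(2) w'(2) exp_add by (simp only: mult_ac)
  ultimately show ?thesis unfolding log_close_def by blast
qed

text \<open>Comparing power series termwise reduces this to the real bound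
  \<open>exp r \<le> 1 + r + r\<^sup>2\<close>.\<close>

lemma norm_exp_minus_1_le:
  fixes w :: complex
  assumes "norm w \<le> r" "r \<le> 1"
  shows "norm (exp w - 1) \<le> r + r\<^sup>2"
proof -
  have "norm (exp w - 1) \<le> exp (norm w) - 1"
  proof -
    have *: "(\<lambda>n. w ^ Suc n /\<^sub>R fact (Suc n)) sums (exp w - 1)"
      "(\<lambda>n. norm w ^ Suc n /\<^sub>R fact (Suc n)) sums (exp (norm w) - 1)"
      using sums_split_initial_segment[OF exp_converges[of w], of 1]
        sums_split_initial_segment[OF exp_converges[of "norm w"], of 1] by simp_all
    have "norm (\<Sum>n. w ^ Suc n /\<^sub>R fact (Suc n)) \<le> (\<Sum>n. norm (w ^ Suc n /\<^sub>R fact (Suc n)))"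
      using sums_summable[OF *(2)]
      by (intro summable_norm) (simp add: norm_mult norm_power del: power_Suc fact_Suc)
    then show ?thesis
      using sums_unique[OF *(1)] sums_unique[OF *(2)]
      by (simp add: norm_mult norm_power del: power_Suc fact_Suc)
  qed
  also have "\<dots> \<le> exp r - 1" using assms by simp
  also have "\<dots> \<le> r + r\<^sup>2"
    using exp_bound[of r] assms norm_ge_zero[of w] by linarith
  finally show ?thesis .
qed

lemma log_close_norm_diff:
  assumes "log_close r x y" "r \<le> 1"
  shows "norm (x - y) \<le> (r + r\<^sup>2) * norm y"
proof -
  obtain w where w: "norm w \<le> r" "x = exp w * y" using assms unfolding log_close_def by auto
  have "norm (x - y) = norm (exp w - 1) * norm y" using w by (simp add: left_diff_distrib flip: norm_mult)
  then show ?thesis using norm_exp_minus_1_le[OF w(1) assms(2)] by (simp add: mult_right_mono)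
qed

text \<open>With \<open>x = (1 + z) * y\<close>, the exponent \<open>Ln (1 + z)\<close> has norm at
  most \<open>norm z / (1 - norm z)\<close>, hence at most \<open>t / (1 - t)\<close>.\<close>

lemma log_closeI:
  assumes d: "norm (x - y) \<le> t * norm y" and "y \<noteq> 0" "t < 1" and r: "t \<le> r * (1 - t)"
  shows "log_close r x y"
proof -
  define z where "z = (x - y) / y"
  have z: "norm z \<le> t" "x = (1 + z) * y"
    using assms by (auto simp: z_def norm_divide divide_le_eq field_simps)
  then have z1: "norm z < 1" using assms by linarith
  have "1 + z \<noteq> 0" using z1 by (metis add.inverse_unique less_irrefl norm_minus_cancel norm_one)
  then have e: "exp (Ln (1 + z)) = 1 + z" by simp
  have "norm (Ln (1 + z)) \<le> norm z + norm (Ln (1 + z) - z)"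
    using norm_triangle_sub by blast
  also have "\<dots> \<le> norm z + (norm z)\<^sup>2 / (1 - norm z)" using Ln_approx_linear[OF z1] by simp
  also have "\<dots> = norm z / (1 - norm z)" using z1 by (simp add: field_simps power2_eq_square)
  also have "\<dots> \<le> t / (1 - t)" using z(1) assms(3) by (intro frac_le) (auto intro: order_trans[OF norm_ge_zero])
  also have "\<dots> \<le> r" using r assms(3) by (simp add: divide_le_eq)
  finally show ?thesis using z e unfolding log_close_def by metis
qed

text \<open>\<open>D\<close> bounds the exponents, \<open>\<delta>\<close> is the resulting relative
  error, and \<open>t\<close> is the relative error between the two averages. To first order
  \<open>t\<close> is \<open>D / (d + 1) = 2 * \<eta> - \<eta> / (d + 1)\<close>. The slack
  \<open>\<eta> / (d + 1)\<close> must absorb terms of order \<open>D\<^sup>2 / (d + 1)\<close>,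
  which is why \<open>\<eta>\<close> has to be small against
  \<open>1 / (2 * d + 1)\<^sup>2\<close>.\<close>

lemma contraction_constants:
  fixes \<eta> :: real
  assumes "\<eta> \<ge> 0" "100 * (2 * real d + 1)\<^sup>2 * \<eta> \<le> 1"
  defines "D \<equiv> (2 * real d + 1) * \<eta>"
  defines "\<delta> \<equiv> D + D\<^sup>2"
  defines "t \<equiv> \<delta> * (1 + \<delta>) / ((real d + 1) * (1 - \<delta>))"
  shows "0 \<le> D" "D \<le> 1 / 100" "0 \<le> \<delta>" "\<delta> \<le> 2 / 100" "t < 1" "t \<le> 2 * \<eta> * (1 - t)"
proof -
  define k where "k = 2 * real d + 1"
  have k: "k \<ge> 1" by (simp add: k_def)
  have kD: "100 * (k * D) \<le> 1" using assms(2) by (simp add: D_def k_def power2_eq_square mult_ac)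
  show D0: "0 \<le> D" using assms(1) by (simp add: D_def)
  have "D \<le> k * D" using k D0 by (simp add: mult_le_cancel_right1)
  then show D1: "D \<le> 1 / 100" using kD by linarith
  have D2: "D\<^sup>2 \<le> D / 100" using mult_left_mono[OF D1 D0] by (simp add: power2_eq_square)
  show d0: "0 \<le> \<delta>" using D0 by (simp add: \<delta>_def)
  show d1: "\<delta> \<le> 2 / 100" using D1 D2 unfolding \<delta>_def by linarith
  have eD: "\<eta> \<le> D" using k assms(1) by (simp add: D_def mult_le_cancel_right1)
  have \<delta>D: "\<delta> \<le> 101 / 100 * D" using D2 by (simp add: \<delta>_def)
  have "t \<le> \<delta> * (1 + \<delta>) / (1 * (1 - \<delta>))"
    unfolding t_def using d0 d1 by (intro divide_left_mono mult_right_mono mult_pos_pos) auto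
  also have "\<dots> \<le> (2/100) * (102/100) / (98/100)"
    using d0 d1 by (intro frac_le mult_mono) auto
  also have "\<dots> < 1" by simp
  finally show "t < 1" .
  \<comment> \<open>The goal is \<open>t * (1 + 2 * \<eta>) \<le> 2 * \<eta>\<close> with
    denominators cleared. All second order terms are collected in a generous factor
    \<open>1 + 10 * D\<close>.\<close>
  have "\<delta> * (1 + \<delta>) * (1 + 2 * \<eta>) \<le> (D * (1 + D)) * (1 + 101/100 * D) * (1 + 2 * D)"
    using d0 D0 \<delta>D eD assms(1) by (intro mult_mono) (auto simp: \<delta>_def power2_eq_square algebra_simps)
  also have "\<dots> \<le> D * ((1 + 10 * D) * (1 - 101/100 * D))"
  proof -
    have "(1 + D) * (1 + 101/100 * D) * (1 + 2 * D) = 1 + 401/100 * D + 503/100 * D\<^sup>2 + 202/100 * (D\<^sup>2 * D)"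
      by (simp add: field_simps power2_eq_square)
    moreover have "D\<^sup>2 * D \<le> D\<^sup>2 * (1 / 100)" using D1 by (intro mult_left_mono) auto
    then have "D\<^sup>2 * D \<le> D / 100" using D2 D0 by linarith
    moreover have "(1 + 10 * D) * (1 - 101/100 * D) = 1 + 899/100 * D - 101/10 * D\<^sup>2"
      by (simp add: field_simps power2_eq_square)
    ultimately have "(1 + D) * (1 + 101/100 * D) * (1 + 2 * D) \<le> (1 + 10 * D) * (1 - 101/100 * D)"
      using D2 D0 by linarith
    from mult_left_mono[OF this D0] show ?thesis by (simp add: mult.assoc)
  qed
  also have "\<dots> \<le> D * (1 + 10 * D) * (1 - \<delta>)"
    unfolding mult.assoc using \<delta>D D0 by (intro mult_left_mono) auto
  \<comment> \<open>The gap between \<open>2 * d + 1\<close> and \<open>2 * d + 2\<close> is used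
    here.\<close>
  also have "D * (1 + 10 * D) \<le> 2 * \<eta> * (real d + 1)"
  proof -
    have "k * (10 * D) \<le> 1" using kD D0 k by simp
    then have "k + k * (10 * D) \<le> 2 * (real d + 1)" by (simp add: k_def)
    from mult_left_mono[OF this assms(1)] show ?thesis by (simp add: D_def k_def algebra_simps)
  qed
  then have "D * (1 + 10 * D) * (1 - \<delta>) \<le> 2 * \<eta> * (real d + 1) * (1 - \<delta>)"
    using d1 by (intro mult_right_mono) auto
  finally have "\<delta> * (1 + \<delta>) * (1 + 2 * \<eta>) \<le> 2 * \<eta> * ((real d + 1) * (1 - \<delta>))"
    by (simp only: mult.assoc)
  then have "t * (1 + 2 * \<eta>) \<le> 2 * \<eta>"
    using d1 by (simp add: t_def divide_le_eq)
  then show "t \<le> 2 * \<eta> * (1 - t)" by (simp add: algebra_simps)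
qed

text \<open>Exponents are turned into relative errors around one value \<open>x = X b\<close>, the
  averages are compared additively, and the result is turned back. In \<open>t\<close>, the factor
  \<open>1 + \<delta>\<close> bounds all values by \<open>x\<close> from above and
  \<open>1 - \<delta>\<close> bounds the average from below.\<close>

lemma log_close_wavg_remove:
  fixes X :: "'b \<Rightarrow> complex" and \<eta> :: real
  assumes fin: "finite L" and ne: "L - {j} \<noteq> {}" and pos: "\<And>c. c \<in> L \<Longrightarrow> n c > 0"
    and bound: "\<And>c. c \<in> L \<Longrightarrow> (real d + 2) * n c \<le> sum n L"
    and X0: "\<And>c. c \<in> L \<Longrightarrow> X c \<noteq> 0"
    and close: "\<And>c c'. c \<in> L \<Longrightarrow> c' \<in> L \<Longrightarrow> log_close ((2 * real d + 1) * \<eta>) (X c) (X c')"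
    and eta: "\<eta> \<ge> 0" "100 * (2 * real d + 1)\<^sup>2 * \<eta> \<le> 1"
  shows "log_close (2 * \<eta>) (wavg n X (L - {i})) (wavg n X (L - {j}))"
proof -
  define D \<delta> where "D = (2 * real d + 1) * \<eta>" and "\<delta> = D + D\<^sup>2"
  define t where "t = \<delta> * (1 + \<delta>) / ((real d + 1) * (1 - \<delta>))"
  note C = contraction_constants[OF eta, folded D_def, folded \<delta>_def, folded t_def]
  obtain b where b: "b \<in> L" using ne by auto
  define x where "x = X b"
  have x0: "norm x > 0" using X0 b by (simp add: x_def)
  have near: "norm (X c - X c') \<le> \<delta> * norm (X c')" if "c \<in> L" "c' \<in> L" for c c'
    using log_close_norm_diff[OF close[OF that], folded D_def] C by (simp add: \<delta>_def)
  have Xle: "norm (X c) \<le> (1 + \<delta>) * norm x" if "c \<in> L" for c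
    using near[OF that b] norm_triangle_sub[of "X c" x] by (simp add: x_def algebra_simps)
  define y where "y = wavg n X (L - {j})"
  have "norm (wavg n X (L - {i}) - y) \<le> (\<delta> * ((1 + \<delta>) * norm x)) / (real d + 1)"
    unfolding y_def
  proof (rule wavg_remove_diff[OF fin pos bound])
    fix c c' assume cc: "c \<in> L" "c' \<in> L"
    show "norm (X c - X c') \<le> \<delta> * ((1 + \<delta>) * norm x)"
      using near[OF cc] mult_left_mono[OF Xle[OF cc(2)] C(3)] by linarith
  qed (use C in auto)
  also have "\<dots> = t * ((1 - \<delta>) * norm x)" using C(4) by (simp add: t_def)
  also have "\<dots> \<le> t * norm y"
  proof (rule mult_left_mono)
    have "norm (y - x) \<le> \<delta> * norm x" unfolding y_def
      using fin ne pos near b by (intro wavg_near) (auto simp: x_def)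
    then show yx: "(1 - \<delta>) * norm x \<le> norm y"
      using norm_triangle_ineq2[of x y] by (simp add: norm_minus_commute algebra_simps)
    show "0 \<le> t" using C by (simp add: t_def)
  qed
  finally have "norm (wavg n X (L - {i}) - y) \<le> t * norm y" .
  moreover have "y \<noteq> 0"
  proof
    assume "y = 0"
    have "norm (y - x) \<le> \<delta> * norm x" unfolding y_def
      using fin ne pos near b by (intro wavg_near) (auto simp: x_def)
    then have "(1 - \<delta>) * norm x \<le> 0" using \<open>y = 0\<close> by (simp add: algebra_simps)
    then show False using C(4) x0 by (simp add: mult_le_0_iff)
  qed
  ultimately show ?thesis using C log_closeI unfolding y_def by blast
qed

section \<open>List colorings\<close>

text \<open>A set of vertices is a parameter so that different colors can be forbidden on different
  parts of a neighborhood, or a color at a single vertex.\<close>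

definition forbid :: "'a set \<Rightarrow> nat \<Rightarrow> ('a \<Rightarrow> nat set) \<Rightarrow> 'a \<Rightarrow> nat set" where
  "forbid A i L v = (if v \<in> A then L v - {i} else L v)"

lemma forbid_empty [simp]: "forbid {} i L = L"
  by (auto simp: forbid_def fun_eq_iff)

locale graph_relation =
  fixes E :: "'a \<Rightarrow> 'a \<Rightarrow> bool"
  assumes sym: "E u v \<Longrightarrow> E v u" and irrefl: "\<not> E v v"
begin

definition nbhd :: "'a set \<Rightarrow> 'a \<Rightarrow> 'a set" where
  "nbhd V v = {w \<in> V. E v w}"

definition colorings :: "'a set \<Rightarrow> ('a \<Rightarrow> nat set) \<Rightarrow> ('a \<Rightarrow> nat) set" where
  "colorings V L = {\<sigma> \<in> Pi\<^sub>E V L. \<forall>u\<in>V. \<forall>v\<in>V. E u v \<longrightarrow> \<sigma> u \<noteq> \<sigma> v}"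

definition Z :: "(nat \<Rightarrow> complex) \<Rightarrow> 'a set \<Rightarrow> ('a \<Rightarrow> nat set) \<Rightarrow> complex" where
  "Z lam V L = (\<Sum>\<sigma>\<in>colorings V L. \<Prod>v\<in>V. lam (\<sigma> v))"

definition N :: "'a set \<Rightarrow> ('a \<Rightarrow> nat set) \<Rightarrow> real" where
  "N V L = real (card (colorings V L))"

lemma finite_nbhd: "finite V \<Longrightarrow> finite (nbhd V v)"
  by (simp add: nbhd_def)

lemma nbhd_insert_self: "nbhd (insert u V) u = nbhd V u"
  using irrefl by (auto simp: nbhd_def)

lemma card_nbhd_insert: "finite V \<Longrightarrow> card (nbhd V v) \<le> card (nbhd (insert u V) v)"
  by (intro card_mono) (auto simp: nbhd_def)

lemma card_nbhd_insert_adjacent: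
  assumes "finite V" "u \<notin> V" "v \<in> nbhd V u"
  shows "card (nbhd (insert u V) v) = Suc (card (nbhd V v))"
proof -
  have "nbhd (insert u V) v = insert u (nbhd V v)" using assms sym by (auto simp: nbhd_def)
  then show ?thesis using assms by (simp add: finite_nbhd) (auto simp: nbhd_def)
qed

lemma finite_colorings: "finite V \<Longrightarrow> (\<And>v. v \<in> V \<Longrightarrow> finite (L v)) \<Longrightarrow> finite (colorings V L)"
  unfolding colorings_def by (rule finite_subset[OF _ finite_PiE[of V L]]) auto

lemma colorings_cong: "(\<And>v. v \<in> V \<Longrightarrow> L v = L' v) \<Longrightarrow> colorings V L = colorings V L'"
  unfolding colorings_def using PiE_cong[of V L L'] by simp

lemma colorings_forbid:
  "A \<subseteq> V \<Longrightarrow> colorings V (forbid A i L) = {\<sigma> \<in> colorings V L. i \<notin> \<sigma> ` A}"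
  by (auto simp: colorings_def forbid_def PiE_iff split: if_splits)

lemma Z_cong: "(\<And>v. v \<in> V \<Longrightarrow> L v = L' v) \<Longrightarrow> Z lam V L = Z lam V L'"
  unfolding Z_def using colorings_cong by metis

lemma N_cong: "(\<And>v. v \<in> V \<Longrightarrow> L v = L' v) \<Longrightarrow> N V L = N V L'"
  unfolding N_def using colorings_cong by metis

text \<open>A coloring is its color \<open>c\<close> at \<open>u\<close> together with a coloring of
  \<open>V\<close> avoiding \<open>c\<close> on the neighbors of \<open>u\<close>. The restriction
  is set to \<open>undefined\<close> at \<open>u\<close> to remain extensional.\<close>

lemma sum_colorings_insert:
  fixes f :: "('a \<Rightarrow> nat) \<Rightarrow> 'b :: comm_monoid_add"
  assumes "finite V" "u \<notin> V" "finite (L u)" "\<And>v. v \<in> V \<Longrightarrow> finite (L v)"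
  shows "sum f (colorings (insert u V) L)
    = (\<Sum>c\<in>L u. \<Sum>\<tau>\<in>colorings V (forbid (nbhd V u) c L). f (\<tau>(u := c)))"
proof -
  have fin: "finite (colorings V (forbid (nbhd V u) c L))" for c
    using assms(1,4) by (intro finite_colorings) (auto simp: forbid_def)
  have "(\<Sum>c\<in>L u. \<Sum>\<tau>\<in>colorings V (forbid (nbhd V u) c L). f (\<tau>(u := c)))
    = (\<Sum>(c, \<tau>)\<in>(SIGMA c:L u. colorings V (forbid (nbhd V u) c L)). f (\<tau>(u := c)))"
    using assms(3) fin by (subst sum.Sigma) auto
  also have "\<dots> = sum f (colorings (insert u V) L)"
  proof (rule sum.reindex_bij_witness[where i = "\<lambda>\<sigma>. (\<sigma> u, \<sigma>(u := undefined))"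
        and j = "\<lambda>(c, \<tau>). \<tau>(u := c)"], goal_cases)
    case (1 a)
    then show ?case
      using assms(2) by (auto simp: colorings_def PiE_iff extensional_def fun_eq_iff)
  next
    case (2 a)
    then obtain c \<tau> where a: "a = (c, \<tau>)" "c \<in> L u" "\<tau> \<in> colorings V (forbid (nbhd V u) c L)"
      by auto
    then have \<tau>: "\<tau> \<in> colorings V L" "c \<notin> \<tau> ` nbhd V u"
      using colorings_forbid[of "nbhd V u" V c L] by (auto simp: nbhd_def)
    have "E u v \<Longrightarrow> v \<in> V \<Longrightarrow> \<tau> v \<noteq> c" "E v u \<Longrightarrow> v \<in> V \<Longrightarrow> \<tau> v \<noteq> c" for v
      using \<tau>(2) sym by (auto simp: nbhd_def)
    then show ?case
      using \<tau>(1) a(1,2) assms(2) irrefl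
      by (auto simp: colorings_def PiE_iff extensional_def)
  next
    case (3 \<sigma>)
    then show ?case by simp
  next
    case (4 \<sigma>)
    then have \<sigma>: "\<sigma> \<in> Pi\<^sub>E (insert u V) L" "\<And>v w. v \<in> insert u V \<Longrightarrow> w \<in> insert u V \<Longrightarrow> E v w \<Longrightarrow> \<sigma> v \<noteq> \<sigma> w"
      by (auto simp: colorings_def)
    have "\<sigma>(u := undefined) \<in> colorings V (forbid (nbhd V u) (\<sigma> u) L)"
    proof -
      have "\<sigma> v \<noteq> \<sigma> u" if "v \<in> nbhd V u" for v
        using \<sigma>(2)[of u v] that by (auto simp: nbhd_def eq_commute)
      moreover have "nbhd V u \<subseteq> V" by (auto simp: nbhd_def)
      ultimately show ?thesis
        using \<sigma> assms(2)
        by (auto simp: colorings_def forbid_def PiE_iff extensional_def)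
    qed
    then show ?case using \<sigma>(1) by auto
  next
    case (5 a)
    then show ?case by auto
  qed
  finally show ?thesis by simp
qed

lemma Z_insert:
  assumes "finite V" "u \<notin> V" "finite (L u)" "\<And>v. v \<in> V \<Longrightarrow> finite (L v)"
  shows "Z lam (insert u V) L = (\<Sum>c\<in>L u. lam c * Z lam V (forbid (nbhd V u) c L))"
proof -
  have "(\<Prod>v\<in>insert u V. lam ((\<tau>(u := c)) v)) = lam c * (\<Prod>v\<in>V. lam (\<tau> v))" for c \<tau>
  proof -
    have "(\<Prod>v\<in>V. lam ((\<tau>(u := c)) v)) = (\<Prod>v\<in>V. lam (\<tau> v))"
      using assms(2) by (intro prod.cong) auto
    then show ?thesis using assms(1,2) by simp
  qed
  then show ?thesis
    unfolding Z_def by (simp only: sum_colorings_insert[of V u L, OF assms] sum_distrib_left)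
qed

lemma N_insert:
  assumes "finite V" "u \<notin> V" "finite (L u)" "\<And>v. v \<in> V \<Longrightarrow> finite (L v)"
  shows "N (insert u V) L = (\<Sum>c\<in>L u. N V (forbid (nbhd V u) c L))"
  using sum_colorings_insert[of V u L "\<lambda>_. 1 :: real", OF assms] by (simp add: N_def)

text \<open>Given a coloring of \<open>V\<close>, at most \<open>d\<close> colors are blocked at \<open>u\<close>.\<close>

lemma marginal_bound:
  assumes "finite V" "finite (L u)" "\<And>v. v \<in> V \<Longrightarrow> finite (L v)"
    and "2 * card (nbhd V u) + 2 \<le> card (L u)"
  shows "(real (card (nbhd V u)) + 2) * N V (forbid (nbhd V u) c L)
    \<le> (\<Sum>c\<in>L u. N V (forbid (nbhd V u) c L))"
proof -
  define T where "T = colorings V L"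
  define B where "B = nbhd V u"
  have T: "finite T" unfolding T_def using assms by (intro finite_colorings)
  have B: "finite B" "B \<subseteq> V" using assms(1) by (auto simp: B_def nbhd_def)
  have n: "N V (forbid B c L) = (\<Sum>\<tau>\<in>T. if c \<notin> \<tau> ` B then 1 else 0)" for c
    unfolding N_def colorings_forbid[OF B(2)] using T by (simp add: T_def flip: sum.inter_filter)
  have "(real (card B) + 2) * N V (forbid B c L) \<le> (real (card B) + 2) * real (card T)"
    unfolding N_def colorings_forbid[OF B(2)] T_def[symmetric]
    using T by (intro mult_left_mono) (auto intro!: card_mono)
  also have "\<dots> = (\<Sum>\<tau>\<in>T. real (card B) + 2)" by simp
  \<comment> \<open>Pairs of a coloring and a color free at \<open>u\<close> are counted twice. Each
    coloring leaves at least \<open>(2 * d + 2) - d\<close> colors.\<close>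
  also have "\<dots> \<le> (\<Sum>\<tau>\<in>T. \<Sum>c\<in>L u. if c \<notin> \<tau> ` B then 1 else 0)"
  proof (rule sum_mono)
    fix \<tau> assume "\<tau> \<in> T"
    have "card (L u) - card (\<tau> ` B) \<le> card (L u - \<tau> ` B)"
      using B by (intro diff_card_le_card_Diff) auto
    moreover have "card (\<tau> ` B) \<le> card B" using B card_image_le by blast
    ultimately have "card B + 2 \<le> card (L u - \<tau> ` B)" using assms(4) unfolding B_def by linarith
    moreover have "(\<Sum>c\<in>L u. if c \<notin> \<tau> ` B then 1 else 0) = real (card (L u - \<tau> ` B))"
      using assms(2) by (simp add: set_diff_eq flip: sum.inter_filter)
    ultimately show "real (card B) + 2 \<le> (\<Sum>c\<in>L u. if c \<notin> \<tau> ` B then 1 else 0)"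
      by linarith
  qed
  also have "\<dots> = (\<Sum>c\<in>L u. N V (forbid B c L))" unfolding n by (rule sum.swap)
  finally show ?thesis unfolding B_def .
qed

end

section \<open>Induction on the vertex set\<close>

text \<open>The hypothesis \<open>2 * deg v \<le> card (L v)\<close> is stable under deleting a vertex and one color from the
  list of each of its neighbors; afterwards those neighbors even satisfy \<open>2 * deg v + 1 \<le> card (L v)\<close>.\<close>

locale weighted_graph_relation = graph_relation E for E :: "'a \<Rightarrow> 'a \<Rightarrow> bool" +
  fixes \<Delta> :: nat and C :: "nat set" and lam :: "nat \<Rightarrow> complex" and \<eta> :: real
  assumes lam_nonzero: "c \<in> C \<Longrightarrow> lam c \<noteq> 0"
    and lam_close: "i \<in> C \<Longrightarrow> j \<in> C \<Longrightarrow> log_close \<eta> (lam i) (lam j)"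
    and eta_nonneg: "\<eta> \<ge> 0" and eta_small: "100 * (2 * real \<Delta> + 1)\<^sup>2 * \<eta> \<le> 1"
begin

text \<open>Nonempty lists are required separately because the degree condition allows an empty list
  at an isolated vertex.\<close>

definition admissible :: "'a set \<Rightarrow> ('a \<Rightarrow> nat set) \<Rightarrow> bool" where
  "admissible V L \<longleftrightarrow> finite V \<and> (\<forall>v\<in>V. finite (L v) \<and> L v \<noteq> {} \<and> L v \<subseteq> C \<and>
     2 * card (nbhd V v) \<le> card (L v) \<and> card (nbhd V v) \<le> \<Delta>)"

text \<open>The numbers of colorings for two colors at a vertex need not be close; dividing them out
  leaves ratios near 1.\<close>

definition mean_weight :: "'a set \<Rightarrow> ('a \<Rightarrow> nat set) \<Rightarrow> complex" where
  "mean_weight V L = Z lam V L / of_real (N V L)"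

definition nonvanishing :: "'a set \<Rightarrow> bool" where
  "nonvanishing V \<longleftrightarrow> (\<forall>L. admissible V L \<longrightarrow> Z lam V L \<noteq> 0 \<and> N V L > 0)"

text \<open>The color of \<open>u\<close> acts only through the lists of its neighbors, so
  \<open>i\<close> and \<open>j\<close> range over \<open>C\<close> and not just over
  \<open>L u\<close>.\<close>

definition ratios_bounded :: "'a set \<Rightarrow> bool" where
  "ratios_bounded V \<longleftrightarrow> (\<forall>L u i j. u \<notin> V \<longrightarrow> admissible (insert u V) L \<longrightarrow> i \<in> C \<longrightarrow> j \<in> C \<longrightarrow>
     log_close ((2 * real (card (nbhd V u)) + 1) * \<eta>)
       (lam i * mean_weight V (forbid (nbhd V u) i L)) (lam j * mean_weight V (forbid (nbhd V u) j L)))"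

lemma eta_small_degree: "d \<le> \<Delta> \<Longrightarrow> 100 * (2 * real d + 1)\<^sup>2 * \<eta> \<le> 1"
  using eta_small mult_right_mono[of "100 * (2 * real d + 1)\<^sup>2" "100 * (2 * real \<Delta> + 1)\<^sup>2" \<eta>] eta_nonneg
  by (smt (verit) power_mono of_nat_0_le_iff of_nat_mono)

text \<open>By disjointness each neighbor of \<open>u\<close> loses at most one color, while its
  degree drops by one. Two colors are needed for the hybrid lists in
  \<open>ratios_bounded_step\<close>.\<close>

lemma admissible_forbid:
  assumes adm: "admissible (insert u V) L" and "u \<notin> V"
    and AB: "A \<subseteq> nbhd V u" "B \<subseteq> nbhd V u" "A \<inter> B = {}"
  shows "admissible V (forbid A i (forbid B j L))"
proof -
  have fin: "finite V" using adm by (simp add: admissible_def)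
  have "finite (M v) \<and> M v \<noteq> {} \<and> M v \<subseteq> C \<and> 2 * card (nbhd V v) \<le> card (M v) \<and> card (nbhd V v) \<le> \<Delta>"
    if M: "M = forbid A i (forbid B j L)" and v: "v \<in> V" for M v
  proof (cases "v \<in> A \<union> B")
    case True
    then have "M v = L v - {i} \<or> M v = L v - {j}" using AB(3) by (auto simp: M forbid_def)
    then obtain k where k: "M v = L v - {k}" by blast
    have "card (nbhd (insert u V) v) = Suc (card (nbhd V v))"
      using True AB fin \<open>u \<notin> V\<close> by (intro card_nbhd_insert_adjacent) auto
    moreover have L: "finite (L v)" "L v \<subseteq> C" "2 * card (nbhd (insert u V) v) \<le> card (L v)"
      "card (nbhd (insert u V) v) \<le> \<Delta>"
      using adm v by (auto simp: admissible_def)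
    moreover have "card (L v) - 1 \<le> card (M v)"
      unfolding k by (metis card_Diff_singleton card_Diff_subset_Int diff_le_self order_refl L(1)
          Diff_empty Diff_insert0)
    \<comment> \<open>From \<open>2 * (deg + 1) - 1\<close>; the extra 1 keeps the list
      nonempty.\<close>
    ultimately have "2 * card (nbhd V v) + 1 \<le> card (M v)" "card (nbhd V v) \<le> \<Delta>" by linarith+
    moreover from this(1) have "M v \<noteq> {}" by auto
    ultimately show ?thesis using k L(1,2) by auto
  next
    case False
    then have "M v = L v" by (auto simp: M forbid_def)
    then show ?thesis
      using adm v card_nbhd_insert[OF fin, of v u] by (auto simp: admissible_def)
  qed
  then show ?thesis using fin unfolding admissible_def by blast
qed

lemma admissible_forbid_nbhd:
  "admissible (insert u V) L \<Longrightarrow> u \<notin> V \<Longrightarrow> admissible V (forbid (nbhd V u) i L)"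
  using admissible_forbid[of u V L "nbhd V u" "{}"] by simp

text \<open>For \<open>c \<in> L u\<close>, \<open>n c\<close> counts the colorings of
  \<open>insert u V\<close> with color \<open>c\<close> at \<open>u\<close>, and \<open>X c\<close>
  is their average weight.\<close>

context
  fixes u V L n X
  assumes u: "u \<notin> V" and adm: "admissible (insert u V) L"
    and nv: "nonvanishing V" and rb: "ratios_bounded V"
  defines "n \<equiv> \<lambda>c. N V (forbid (nbhd V u) c L)"
    and "X \<equiv> \<lambda>c. lam c * mean_weight V (forbid (nbhd V u) c L)"
begin

lemma fin: "finite V" "finite (L u)" "\<And>v. v \<in> V \<Longrightarrow> finite (L v)" "L u \<subseteq> C" "L u \<noteq> {}"
  using adm by (auto simp: admissible_def)

lemma n_pos: "n c > 0"
  using nv admissible_forbid_nbhd[OF adm u] by (simp add: n_def nonvanishing_def)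

lemma n_X: "of_real (n c) * X c = lam c * Z lam V (forbid (nbhd V u) c L)"
  using n_pos[of c] by (simp add: X_def n_def mean_weight_def)

lemma X_nonzero: "c \<in> L u \<Longrightarrow> X c \<noteq> 0"
  using n_X[of c] nv admissible_forbid_nbhd[OF adm u, of c] lam_nonzero fin(4)
  by (auto simp: nonvanishing_def)

lemma X_close:
  "c \<in> L u \<Longrightarrow> c' \<in> L u \<Longrightarrow> log_close ((2 * real (card (nbhd V u)) + 1) * \<eta>) (X c) (X c')"
  using rb u adm fin(4) unfolding ratios_bounded_def X_def by blast

lemma degree_le: "card (nbhd V u) \<le> \<Delta>"
  using adm nbhd_insert_self by (simp add: admissible_def)

lemma N_forbid_insert: "N (insert u V) (forbid {u} i L) = sum n (L u - {i})"
proof -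
  have "N (insert u V) (forbid {u} i L)
      = (\<Sum>c\<in>L u - {i}. N V (forbid (nbhd V u) c (forbid {u} i L)))"
    using fin u by (subst N_insert) (auto simp: forbid_def)
  also have "\<dots> = sum n (L u - {i})"
    unfolding n_def using u by (intro sum.cong refl N_cong) (auto simp: forbid_def)
  finally show ?thesis .
qed

text \<open>Forbidding \<open>i\<close> at \<open>u\<close> only drops one term, since the lists on
  \<open>V\<close> are unchanged. Two forbidden colors thus give averages of the same numbers
  \<open>X c\<close>.\<close>

lemma mean_weight_forbid_insert:
  "mean_weight (insert u V) (forbid {u} i L) = wavg n X (L u - {i})"
proof -
  have "Z lam (insert u V) (forbid {u} i L)
      = (\<Sum>c\<in>L u - {i}. lam c * Z lam V (forbid (nbhd V u) c (forbid {u} i L)))"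
    using fin u by (subst Z_insert) (auto simp: forbid_def)
  also have "\<dots> = (\<Sum>c\<in>L u - {i}. n c * X c)"
    unfolding n_X using u
    by (intro sum.cong refl arg_cong2[where f = "(*)"] Z_cong) (auto simp: forbid_def)
  finally show ?thesis by (simp only: mean_weight_def wavg_def N_forbid_insert)
qed

text \<open>All \<open>X c\<close> lie within 2 percent of one nonzero \<open>X b\<close>, so their
  average cannot vanish.\<close>

lemma nonvanishing_insert: "Z lam (insert u V) L \<noteq> 0 \<and> N (insert u V) L > 0"
proof -
  let ?D = "(2 * real (card (nbhd V u)) + 1) * \<eta>"
  let ?\<delta> = "?D + ?D\<^sup>2"
  note K = contraction_constants[OF eta_nonneg eta_small_degree[OF degree_le]]
  have N: "N (insert u V) L = sum n (L u)" using fin u by (simp add: N_insert n_def)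
  then have pos: "N (insert u V) L > 0" using n_pos fin by (simp add: sum_pos)
  obtain b where b: "b \<in> L u" using fin(5) by auto
  have "norm (wavg n X (L u) - X b) \<le> ?\<delta> * norm (X b)"
    using fin n_pos log_close_norm_diff[OF X_close] b K(2) by (intro wavg_near) auto
  also have "\<dots> < norm (X b)" using K(4) X_nonzero[OF b] by simp
  finally have "wavg n X (L u) \<noteq> 0" by auto
  moreover have "Z lam (insert u V) L = (\<Sum>c\<in>L u. n c * X c)"
    using fin u by (simp add: Z_insert n_X)
  ultimately show ?thesis using pos by (auto simp: wavg_def)
qed

text \<open>The surplus of two colors makes \<open>marginal_bound\<close> applicable; it is
  available when \<open>u\<close> has a further neighbor in a larger graph.\<close>

lemma mean_weight_forbid_close:
  assumes "2 * card (nbhd V u) + 2 \<le> card (L u)"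
  shows "log_close (2 * \<eta>) (mean_weight (insert u V) (forbid {u} i L))
    (mean_weight (insert u V) (forbid {u} j L))"
  unfolding mean_weight_forbid_insert
proof (rule log_close_wavg_remove[where d = "card (nbhd V u)"])
  have "\<not> L u \<subseteq> {j}" using assms card_mono[of "{j}" "L u"] by auto
  then show "L u - {j} \<noteq> {}" by auto
  show "(real (card (nbhd V u)) + 2) * n c \<le> sum n (L u)" for c
    unfolding n_def using fin assms by (intro marginal_bound)
qed (use fin n_pos X_nonzero X_close eta_nonneg eta_small_degree[OF degree_le] in auto)

end

text \<open>The neighbors of \<open>u\<close> are switched from forbidding \<open>j\<close> to
  forbidding \<open>i\<close> one at a time. Each switch costs \<open>2 * \<eta>\<close>, and
  \<open>lam i / lam j\<close> costs a further \<open>\<eta>\<close>.\<close>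

lemma ratios_bounded_step:
  assumes "finite V"
    and IH: "\<And>v. v \<in> V \<Longrightarrow> nonvanishing (V - {v}) \<and> ratios_bounded (V - {v})"
  shows "ratios_bounded V"
  unfolding ratios_bounded_def
proof (intro allI impI)
  fix L u i j
  assume u: "u \<notin> V" and adm: "admissible (insert u V) L" and ij: "i \<in> C" "j \<in> C"
  define B where "B = nbhd V u"
  have "finite B" using assms(1) by (simp add: B_def finite_nbhd)
  have hybrid: "log_close (2 * \<eta> * real (card A)) (mean_weight V (forbid A i (forbid (B - A) j L)))
      (mean_weight V (forbid B j L))" if "A \<subseteq> B" for A
    using finite_subset[OF that \<open>finite B\<close>] that
  proof (induction A rule: finite_induct)
    case empty
    then show ?case by (simp add: log_close_refl)
  next
    case (insert v A)
    \<comment> \<open>\<open>M\<close> leaves \<open>v\<close> unrestricted, so the lists before and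
      after the switch both arise from \<open>M\<close> by forbidding one color at
      \<open>v\<close>.\<close>
    define M where "M = forbid A i (forbid (B - insert v A) j L)"
    have v: "v \<in> B" "v \<in> V" "v \<notin> A" using insert by (auto simp: B_def nbhd_def)
    then have ins: "insert v (V - {v}) = V" by auto
    have adm': "admissible V M"
      unfolding M_def using insert.prems by (intro admissible_forbid[OF adm u]) (auto simp: B_def)
    have Mv: "M v = L v" using v by (simp add: M_def forbid_def)
    have nb: "nbhd (V - {v}) v = nbhd V v" using nbhd_insert_self[of v "V - {v}"] ins by simp
    \<comment> \<open>The deleted neighbor \<open>u\<close> of \<open>v\<close> provides the surplus
      of two colors.\<close>
    have "2 * card (nbhd (insert u V) v) \<le> card (L v)" using adm v by (simp add: admissible_def)
    then have big: "2 * card (nbhd (V - {v}) v) + 2 \<le> card (M v)"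
      using card_nbhd_insert_adjacent[OF assms(1) u, of v] v by (simp add: nb Mv B_def)
    have "log_close (2 * \<eta>) (mean_weight V (forbid {v} i M)) (mean_weight V (forbid {v} j M))"
      using mean_weight_forbid_close[of v "V - {v}" M i j, unfolded ins] IH[OF v(2)] adm' big by simp
    moreover have "forbid {v} i M = forbid (insert v A) i (forbid (B - insert v A) j L)"
      "forbid {v} j M = forbid A i (forbid (B - A) j L)"
      unfolding M_def using v by (auto simp: forbid_def fun_eq_iff)
    ultimately have "log_close (2 * \<eta> + 2 * \<eta> * real (card A))
        (mean_weight V (forbid (insert v A) i (forbid (B - insert v A) j L)))
        (mean_weight V (forbid B j L))"
      using insert.IH insert.prems log_close_trans by simp
    then show ?case using insert.hyps by (simp add: algebra_simps)
  qed
  have "log_close (\<eta> + 2 * \<eta> * real (card B)) (lam i * mean_weight V (forbid B i L))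
      (lam j * mean_weight V (forbid B j L))"
    using log_close_mult[OF lam_close[OF ij] hybrid[OF order_refl]] by simp
  then show "log_close ((2 * real (card (nbhd V u)) + 1) * \<eta>)
      (lam i * mean_weight V (forbid (nbhd V u) i L)) (lam j * mean_weight V (forbid (nbhd V u) j L))"
    by (simp add: B_def algebra_simps)
qed

text \<open>Both properties of \<open>V\<close> rest on both properties of the sets
  \<open>V - {v}\<close>, hence the joint induction.\<close>

lemma nonvanishing_and_ratios_bounded:
  "finite V \<Longrightarrow> nonvanishing V \<and> ratios_bounded V"
proof (induction V rule: finite_psubset_induct)
  case (psubset V)
  have IH: "nonvanishing (V - {v}) \<and> ratios_bounded (V - {v})" if "v \<in> V" for v
    using psubset.IH[of "V - {v}"] that by auto
  have "nonvanishing V"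
  proof (cases "V = {}")
    case True
    then show ?thesis by (simp add: nonvanishing_def Z_def N_def colorings_def)
  next
    case False
    then obtain v where v: "v \<in> V" by auto
    then have "insert v (V - {v}) = V" by auto
    then show ?thesis
      unfolding nonvanishing_def using nonvanishing_insert[of v "V - {v}", unfolded \<open>insert v (V - {v}) = V\<close>] IH[OF v] by simp
  qed
  then show ?case using ratios_bounded_step[OF psubset.hyps IH] by simp
qed

theorem Z_nonzero: "admissible V L \<Longrightarrow> Z lam V L \<noteq> 0"
  using nonvanishing_and_ratios_bounded[of V] by (auto simp: nonvanishing_def admissible_def)

end

section \<open>The coloring model\<close>

text \<open>The exponent \<open>Ln (lam i) - Ln (lam j)\<close> has real part at most
  \<open>\<Delta> * eps_I \<Delta>\<close> and imaginary part at most
  \<open>nu * eps_I \<Delta>\<close> in absolute value.\<close>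

lemma log_close_valid_weights:
  assumes val: "valid_weights \<Delta> q lam" and "\<Delta> \<ge> 1" and ij: "i \<in> {1..q}" "j \<in> {1..q}"
  shows "log_close (2 * real \<Delta> * eps_I \<Delta>) (lam i) (lam j)"
proof -
  have nz: "lam k \<noteq> 0" and Im: "\<bar>Im (Ln (lam k))\<bar> \<le> 9 / 20 * eps_I \<Delta>" if "k \<in> {1..q}" for k
    using val that unfolding valid_weights_def nu_def by force+
  define w where "w = Ln (lam i) - Ln (lam j)"
  \<comment> \<open>The real part of \<open>Ln\<close> is the logarithm of the modulus, so branches
    do not matter.\<close>
  have "Re w = Re (Ln (lam i / lam j))"
    using nz ij by (simp add: w_def norm_divide ln_div)
  then have re: "\<bar>Re w\<bar> \<le> real \<Delta> * eps_I \<Delta>"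
    using val ij unfolding valid_weights_def by metis
  have im: "\<bar>Im w\<bar> \<le> eps_I \<Delta>"
    using Im[OF ij(1)] Im[OF ij(2)] unfolding w_def minus_complex.sel by linarith
  have "eps_I \<Delta> \<le> real \<Delta> * eps_I \<Delta>"
    using \<open>\<Delta> \<ge> 1\<close> mult_right_mono[of 1 "real \<Delta>" "eps_I \<Delta>"] by (simp add: eps_I_def)
  then have "norm w \<le> 2 * real \<Delta> * eps_I \<Delta>"
    using cmod_le[of w] re im by linarith
  moreover have "lam i = exp w * lam j" using nz ij by (simp add: w_def exp_diff)
  ultimately show ?thesis unfolding log_close_def by blast
qed

text \<open>Using \<open>2 * \<Delta> + 1 \<le> 3 * \<Delta>\<close>, the left side is at most
  \<open>100 * 9 * 2 / 10 ^ 4 / \<Delta>\<close>.\<close>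

lemma eps_I_small:
  assumes "\<Delta> \<ge> 1"
  shows "100 * (2 * real \<Delta> + 1)\<^sup>2 * (2 * real \<Delta> * eps_I \<Delta>) \<le> 1"
proof -
  have D: "real \<Delta> \<ge> 1" using assms by simp
  have "(2 * real \<Delta> + 1)\<^sup>2 \<le> (3 * real \<Delta>)\<^sup>2" using D by (intro power_mono) auto
  then have "100 * (2 * real \<Delta> + 1)\<^sup>2 * (2 * real \<Delta> * eps_I \<Delta>)
      \<le> 100 * (3 * real \<Delta>)\<^sup>2 * (2 * real \<Delta> * eps_I \<Delta>)"
    by (intro mult_right_mono) (auto simp: eps_I_def)
  also have "\<dots> = 9 / (50 * real \<Delta>)"
    using D by (simp add: eps_I_def field_simps eval_nat_numeral)
  also have "\<dots> \<le> 1" using D by simp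
  finally show ?thesis .
qed

lemma out_degree_le_max_degree:
  "finite (pverts G) \<Longrightarrow> v \<in> pverts G \<Longrightarrow> out_degree (with_proj G) v \<le> max_degree G"
  unfolding max_degree_def by (intro Max_ge) auto

theorem mainTheorem4:
  fixes G :: "'a pair_pre_digraph"
    and \<Delta> q :: nat
    and lam :: "nat \<Rightarrow> complex"
  assumes "\<Delta> \<ge> 1"
    and "q \<ge> 2 * \<Delta>"
    and "pair_graph G"
    and "max_degree G = \<Delta>"
    and "valid_weights \<Delta> q lam"
  shows "coloring_partition_function G q lam \<noteq> 0"
proof -
  interpret pair_graph G by fact
  have V: "finite (pverts G)" by (rule pair_finite_verts)
  interpret graph_relation "\<lambda>u v. (u, v) \<in> parcs G"
  proof
    show "(u, v) \<in> parcs G \<Longrightarrow> (v, u) \<in> parcs G" for u v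
      using pair_sym_arcs by (auto simp: symmetric_def dest: symD)
    show "(v, v) \<notin> parcs G" for v
      using pair_no_loops by fastforce
  qed
  interpret weighted_graph_relation "\<lambda>u v. (u, v) \<in> parcs G" \<Delta> "{1..q}" lam "2 * real \<Delta> * eps_I \<Delta>"
  proof
    show "lam c \<noteq> 0" if "c \<in> {1..q}" for c
      using assms(5) that unfolding valid_weights_def by force
  qed (use assms eps_I_small log_close_valid_weights in \<open>auto simp: eps_I_def\<close>)
  have "card (nbhd (pverts G) v) \<le> \<Delta>" if "v \<in> pverts G" for v
  proof -
    \<comment> \<open>Arcs are pairs, so there are no parallel arcs and the out-degree counts
      neighbors.\<close>
    have "bij_betw snd (out_arcs (with_proj G) v) (nbhd (pverts G) v)"
      by (rule bij_betw_byWitness[where f' = "Pair v"])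
        (auto simp: out_arcs_def nbhd_def dest: in_arcsD2)
    then show ?thesis
      using out_degree_le_max_degree[OF V that] assms(4)
      by (simp add: out_degree_def bij_betw_same_card)
  qed
  then have "card (nbhd (pverts G) v) \<le> \<Delta> \<and> 2 * card (nbhd (pverts G) v) \<le> q" if "v \<in> pverts G" for v
    using assms(2) that order_trans mult_le_mono2 by meson
  then have "admissible (pverts G) (\<lambda>_. {1..q})"
    using V assms(1,2) unfolding admissible_def by simp
  moreover have "coloring_partition_function G q lam = Z lam (pverts G) (\<lambda>_. {1..q})"
  proof -
    have col: "proper_colorings G q = colorings (pverts G) (\<lambda>_. {1..q})"
      by (auto simp: proper_colorings_def colorings_def dest: in_arcsD1 in_arcsD2)
    have "(\<Prod>i = 1..q. lam i ^ card {v \<in> pverts G. \<sigma> v = i}) = (\<Prod>v\<in>pverts G. lam (\<sigma> v))"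
      if "\<sigma> \<in> proper_colorings G q" for \<sigma>
    proof -
      have "\<sigma> ` pverts G \<subseteq> {1..q}" using that by (auto simp: proper_colorings_def)
      \<comment> \<open>Grouping the vertices by color turns the product over vertices into
        powers.\<close>
      from prod.group[OF V _ this, of "\<lambda>v. lam (\<sigma> v)"] show ?thesis by simp
    qed
    then show ?thesis
      unfolding coloring_partition_function_def Z_def col[symmetric] by (rule sum.cong[OF refl])
  qed
  ultimately show ?thesis using Z_nonzero by simp
qed

end
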